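(* Let $a,b$ be nonzero real numbers, and let $u_0,u_1,v_0,v_1$ be real numbers with $u_0v_1\neq 0$ and $v_0u_1\neq 0$. Put $S_0=\frac{1}{v_0u_1}$, $T_0=\frac{1}{u_0v_1}$ and, for every integer $n\ge 0$, $$S_{2n}=a^nb^nS_0+\sum_{i=0}^{n-1}a^ib^i+\sum_{i=0}^{n-1}a^{i+1}b^i,\qquad T_{2n}=a^nb^nT_0+\sum_{i=0}^{n-1}a^ib^i+\sum_{i=0}^{n-1}a^ib^{i+1},$$ $$S_{2n+1}=a^{n+1}b^nT_0+\sum_{i=0}^{n}a^ib^i+\sum_{i=0}^{n-1}a^{i+1}b^i,\qquad T_{2n+1}=a^nb^{n+1}S_0+\sum_{i=0}^{n}a^ib^i+\sum_{i=0}^{n-1}a^ib^{i+1}.$$ Assume that $S_k\neq 0$ and $T_k\neq 0$ for all $k\ge 0$. Then the solution $(u_n,v_n)_{n\ge 0}$, with the given initial values $u_0,u_1,v_0,v_1$, of the system of difference equations $$u_{n+2}=\frac{u_n}{a+u_nv_{n+1}},\qquad v_{n+2}=\frac{v_n}{b+v_nu_{n+1}}\qquad(n\ge 0)$$ is well defined (no denominator vanishes) and is given, for all $n\ge 0$, by $$u_{2n}=u_0\prod_{r=0}^{n-1}\frac{T_{2r}}{S_{2r+1}},\qquad v_{2n}=v_0\prod_{r=0}^{n-1}\frac{S_{2r}}{T_{2r+1}},$$ $$u_{2n+1}=\frac{\prod_{r=0}^{n-1}T_{2r+1}}{v_0\prod_{r=0}^{n}S_{2r}},\qquad v_{2n+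1}=\frac{\prod_{r=0}^{n-1}S_{2r+1}}{u_0\prod_{r=0}^{n}T_{2r}}.$$
   Context: Empty sums equal $0$ and empty products equal $1$. *)

theory Defs
  imports Complex_Main
begin

text \<open>
  Division in HOL is total, so a genuine solution has to satisfy explicitly that no
  denominator of the system vanishes.
\<close>

definition solves_system ::
  "real \<Rightarrow> real \<Rightarrow> real \<Rightarrow> real \<Rightarrow> real \<Rightarrow> real \<Rightarrow> (nat \<Rightarrow> real) \<Rightarrow> (nat \<Rightarrow> real) \<Rightarrow> bool"
where
  "solves_system a b u0 u1 v0 v1 u v \<longleftrightarrow>
     u 0 = u0 \<and> u 1 = u1 \<and> v 0 = v0 \<and> v 1 = v1 \<and>
     (\<forall>n. a + u n * v (n + 1) \<noteq> 0 \<and> b + v n * u (n + 1) \<noteq> 0 \<and>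
          u (n + 2) = u n / (a + u n * v (n + 1)) \<and>
          v (n + 2) = v n / (b + v n * u (n + 1)))"

end

(* The reciprocals of v(n) u(n+1) and u(n) v(n+1) satisfy the linear recurrences
   S(n+1) = a T(n) + 1 and T(n+1) = b S(n) + 1, of which the given S, T are the closed forms.
   Hence a + u(n) v(n+1) = S(n+1) / T(n), the system reads u(n+2) = u(n) T(n) / S(n+1) and
   v(n+2) = v(n) S(n) / T(n+1), and the formulas for u, v are telescoping products. *)
theory Submission imports Defs begin

text \<open>The recurrence has order two, so the induction carries the values at two consecutive
  indices.\<close>

lemma solves_system_unique:
  assumes "solves_system a b u0 u1 v0 v1 u v" and "solves_system a b u0 u1 v0 v1 u' v'"
  shows "u' = u \<and> v' = v"
proof -
  have "u' n = u n \<and> v' n = v n \<and> u' (Suc n) = u (Suc n) \<and> v' (Suc n) = v (Suc n)" for n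
    using assms by (induction n) (auto simp: solves_system_def)
  then show ?thesis by blast
qed

text \<open>Separates the dynamics from the closed forms: of \<open>S\<close> and \<open>T\<close>,
  only the initial values, the linear recurrences and non-vanishing enter.\<close>

lemma solves_systemI_linear:
  fixes a b u0 u1 v0 v1 :: real and S T u v :: "nat \<Rightarrow> real"
  assumes nz: "u0 * v1 \<noteq> 0" "v0 * u1 \<noteq> 0" "\<And>k. S k \<noteq> 0" "\<And>k. T k \<noteq> 0"
    and init: "S 0 = 1 / (v0 * u1)" "T 0 = 1 / (u0 * v1)"
    and lin: "\<And>n. S (Suc n) = a * T n + 1" "\<And>n. T (Suc n) = b * S n + 1"
    and uv: "u 0 = u0" "u 1 = u1" "v 0 = v0" "v 1 = v1"
    and step: "\<And>n. u (n + 2) = u n * T n / S (Suc n)" "\<And>n. v (n + 2) = v n * S n / T (Suc n)"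
  shows "solves_system a b u0 u1 v0 v1 u v"
proof -
  \<comment> \<open>Both halves go through one induction because each feeds the other:
    \<open>u (n + 1) * v (n + 2)\<close> equals \<open>(v n * u (n + 1)) * S n / T (n + 1)\<close>,
    where the bracket cancels \<open>S n\<close>.\<close>
  have inv: "u n * v (Suc n) = 1 / T n \<and> v n * u (Suc n) = 1 / S n" for n
  proof (induction n)
    case 0
    then show ?case using uv init by simp
  next
    case (Suc n)
    then have "u n * v (Suc n) * T n = 1" "v n * u (Suc n) * S n = 1"
      using nz by simp_all
    then show ?case
      using step[of n] by (simp add: mult_ac)
  qed
  \<comment> \<open>By \<open>inv\<close> and \<open>lin\<close>, a + 1 / T n = (a * T n + 1) / T n.
    A quotient of nonzero terms, so no denominator of the system vanishes.\<close>
  have "a + u n * v (n + 1) = S (Suc n) / T n" "b + v n * u (n + 1) = T (Suc n) / S n" for n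
    using inv[of n] nz(3,4)[of n] by (simp_all add: lin field_simps)
  then show ?thesis
    using nz(3,4) uv step unfolding solves_system_def by simp
qed

theorem mainTheorem1:
  fixes a b u0 u1 v0 v1 :: real and S T :: "nat \<Rightarrow> real"
  assumes "a \<noteq> 0" and "b \<noteq> 0"
    and "u0 * v1 \<noteq> 0" and "v0 * u1 \<noteq> 0"
    and "S 0 = 1 / (v0 * u1)" and "T 0 = 1 / (u0 * v1)"
    and "\<forall>n. S (2 * n) = a ^ n * b ^ n * S 0 + (\<Sum>i<n. a ^ i * b ^ i) + (\<Sum>i<n. a ^ (i + 1) * b ^ i)"
    and "\<forall>n. T (2 * n) = a ^ n * b ^ n * T 0 + (\<Sum>i<n. a ^ i * b ^ i) + (\<Sum>i<n. a ^ i * b ^ (i + 1))"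
    and "\<forall>n. S (2 * n + 1) = a ^ (n + 1) * b ^ n * T 0 + (\<Sum>i\<le>n. a ^ i * b ^ i) + (\<Sum>i<n. a ^ (i + 1) * b ^ i)"
    and "\<forall>n. T (2 * n + 1) = a ^ n * b ^ (n + 1) * S 0 + (\<Sum>i\<le>n. a ^ i * b ^ i) + (\<Sum>i<n. a ^ i * b ^ (i + 1))"
    and "\<forall>k. S k \<noteq> 0 \<and> T k \<noteq> 0"
  shows "\<exists>u v. solves_system a b u0 u1 v0 v1 u v \<and>
    (\<forall>u' v'. solves_system a b u0 u1 v0 v1 u' v' \<longrightarrow> u' = u \<and> v' = v) \<and>
    (\<forall>n. u (2 * n) = u0 * (\<Prod>r<n. T (2 * r) / S (2 * r + 1)) \<and>
         v (2 * n) = v0 * (\<Prod>r<n. S (2 * r) / T (2 * r + 1)) \<and>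
         u (2 * n + 1) = (\<Prod>r<n. T (2 * r + 1)) / (v0 * (\<Prod>r\<le>n. S (2 * r))) \<and>
         v (2 * n + 1) = (\<Prod>r<n. S (2 * r + 1)) / (u0 * (\<Prod>r\<le>n. T (2 * r))))"
proof -
  have nz: "S k \<noteq> 0" "T k \<noteq> 0" for k
    using assms(11) by auto
  have nz0: "u0 \<noteq> 0" "v0 \<noteq> 0"
    using assms(3,4) by auto
  have lin: "S (Suc n) = a * T n + 1 \<and> T (Suc n) = b * S n + 1" for n
  proof (cases "even n")
    case True
    then obtain m where n: "n = 2 * m" by blast
    \<comment> \<open>In \<open>a * T (2 * m) + 1\<close> the summand 1 is the missing term i = 0 of
      the sum of \<open>a ^ i * b ^ i\<close>. Hence sums are split at their first term, and the
      rule splitting off the last one is disabled.\<close>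
    show ?thesis
      using assms(7-10)[rule_format, of m]
      by (simp add: n lessThan_Suc_atMost[symmetric] sum.lessThan_Suc_shift sum_distrib_left
          algebra_simps del: sum.lessThan_Suc)
  next
    case False
    then obtain m where n: "n = 2 * m + 1" by (rule oddE)
    have "Suc n = 2 * Suc m" by (simp add: n)
    \<comment> \<open>Here only the sum of \<open>a ^ i * b ^ i\<close> must be shifted to absorb
      the 1, so the shift is supplied for that summand alone.\<close>
    then show ?thesis
      using assms(9,10)[rule_format, of m] assms(7,8)[rule_format, of "Suc m"]
        sum.lessThan_Suc_shift[of "\<lambda>i. a ^ i * b ^ i" m]
      by (simp add: n lessThan_Suc_atMost[symmetric] sum_distrib_left algebra_simps)
  qed
  define u where "u k = (let n = k div 2 in
      if even k then u0 * (\<Prod>r<n. T (2 * r) / S (2 * r + 1))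
      else (\<Prod>r<n. T (2 * r + 1)) / (v0 * (\<Prod>r\<le>n. S (2 * r))))" for k
  define v where "v k = (let n = k div 2 in
      if even k then v0 * (\<Prod>r<n. S (2 * r) / T (2 * r + 1))
      else (\<Prod>r<n. S (2 * r + 1)) / (u0 * (\<Prod>r\<le>n. T (2 * r))))" for k
  have formulas: "u (2 * n) = u0 * (\<Prod>r<n. T (2 * r) / S (2 * r + 1))"
    "v (2 * n) = v0 * (\<Prod>r<n. S (2 * r) / T (2 * r + 1))"
    "u (2 * n + 1) = (\<Prod>r<n. T (2 * r + 1)) / (v0 * (\<Prod>r\<le>n. S (2 * r)))"
    "v (2 * n + 1) = (\<Prod>r<n. S (2 * r + 1)) / (u0 * (\<Prod>r\<le>n. T (2 * r)))" for n
    by (simp_all add: u_def v_def)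
  \<comment> \<open>Passing from m to m + 1 in \<open>formulas\<close> appends exactly one factor to
    each product.\<close>
  have step: "u (n + 2) = u n * T n / S (Suc n) \<and> v (n + 2) = v n * S n / T (Suc n)" for n
  proof (cases "even n")
    case True
    then obtain m where "n = 2 * m" by blast
    then show ?thesis
      using formulas(1,2)[of m] formulas(1,2)[of "Suc m"] by simp
  next
    case False
    then obtain m where "n = 2 * m + 1" by (rule oddE)
    then show ?thesis
      using formulas(3,4)[of m] formulas(3,4)[of "Suc m"] by (simp add: mult_ac)
  qed
  have "solves_system a b u0 u1 v0 v1 u v"
  proof (rule solves_systemI_linear[where S = S and T = T])
    \<comment> \<open>At n = 0 the products over r < 0 are empty, but those over r \<le> 0 keep one
      factor: \<open>u 1\<close> is \<open>1 / (v0 * S 0)\<close>, which is \<open>u1\<close> by the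
      choice of \<open>S 0\<close>.\<close>
    show "u 0 = u0" "u 1 = u1" "v 0 = v0" "v 1 = v1"
      using formulas[of 0] assms(5,6) nz0 by simp_all
  qed (use assms(3-6) nz lin step in auto)
  then show ?thesis
    using solves_system_unique formulas by blast
qed

end
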